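(* The set of statistical mixtures of Poincaré distributions, $$\left\{\sum_{i=1}^nw_i\,p_{\theta_i}:\ n\ge1,\ \theta_1,\dots,\theta_n\in\mathrm{Sym}^+(2,\mathbb{R}),\ w_i\ge0,\ \sum_{i=1}^nw_i=1\right\},$$ is dense in the space of (Borel) probability distributions on $\mathbb{H}$ for the topology of weak convergence.
   Context: $\mathbb{H}=\{(x,y)\in\mathbb{R}^2: y>0\}$. $\mathrm{Sym}^+(2,\mathbb{R})$ is the set of real symmetric positive-definite $2\times2$ matrices. For $\theta=\begin{bmatrix} a & b \\ b & c \end{bmatrix}\in\mathrm{Sym}^+(2,\mathbb{R})$, the Poincaré distribution $p_\theta$ is the probability distribution on $\mathbb{H}$ with density (with respect to $dx\,dy$) $$p_\theta(x,y)=\frac{\sqrt{ac-b^2}\,e^{2\sqrt{ac-b^2}}}{\pi}\exp\left(-\frac{a(x^2+y^2)+2bx+c}{y}\right)\frac1{y^2}.$$ Weak convergence means convergence of integrals of bounded continuous functions on $\mathbb{H}$. *)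

theory Defs
  imports "HOL-Probability.Probability"
begin

definition upper_half_plane :: "(real \<times> real) set"
  where "upper_half_plane = {(x, y). y > 0}"

definition sym_pos_def :: "(real^2^2) set"
  where "sym_pos_def = {\<theta>. transpose \<theta> = \<theta> \<and> (\<forall>v. v \<noteq> 0 \<longrightarrow> v \<bullet> (\<theta> *v v) > 0)}"

definition poincare_density :: "real^2^2 \<Rightarrow> real \<times> real \<Rightarrow> real"
  where "poincare_density \<theta> = (\<lambda>(x, y).
    let a = \<theta>$1$1; b = \<theta>$1$2; c = \<theta>$2$2; d = sqrt (a * c - b\<^sup>2)
    in d * exp (2 * d) / pi * exp (- ((a * (x\<^sup>2 + y\<^sup>2) + 2 * b * x + c) / y)) * (1 / y\<^sup>2))"

definition poincare_mixture :: "nat \<Rightarrow> (nat \<Rightarrow> real) \<Rightarrow> (nat \<Rightarrow> real^2^2) \<Rightarrow> (real \<times> real) measure"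
  where "poincare_mixture n w \<theta> =
    density (restrict_space lborel upper_half_plane)
      (\<lambda>z. ennreal (\<Sum>i=1..n. w i * poincare_density (\<theta> i) z))"

definition poincare_mixtures :: "(real \<times> real) measure set"
  where "poincare_mixtures = {poincare_mixture n w \<theta> | n w \<theta>.
    n \<ge> 1 \<and> (\<forall>i\<in>{1..n}. \<theta> i \<in> sym_pos_def) \<and> (\<forall>i\<in>{1..n}. w i \<ge> 0) \<and> (\<Sum>i=1..n. w i) = 1}"

definition borel_prob_measures :: "'a::topological_space set \<Rightarrow> 'a measure set"
  where "borel_prob_measures S = {M. prob_space M \<and> sets M = sets (restrict_space borel S)}"

(* The coarsest topology on the Borel probability measures on S for which integration against
   each bounded continuous function on S is continuous; see limitin_weak_topology. *)
definition weak_topology :: "'a::topological_space set \<Rightarrow> 'a measure topology"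
  where "weak_topology S = topology_generated_by
    {{M \<in> borel_prob_measures S. integral\<^sup>L M f \<in> U} | (f :: 'a \<Rightarrow> real) U.
      continuous_on S f \<and> bounded (f ` S) \<and> open U}"

lemma openin_weak_topology_basic:
  fixes f :: "'a::topological_space \<Rightarrow> real"
  assumes "continuous_on S f" "bounded (f ` S)" "open U"
  shows "openin (weak_topology S) {M \<in> borel_prob_measures S. integral\<^sup>L M f \<in> U}"
  unfolding weak_topology_def
  by (rule topology_generated_by_Basis, rule CollectI, rule exI[of _ f], rule exI[of _ U])
     (simp add: assms)

lemma topspace_weak_topology: "topspace (weak_topology S) = borel_prob_measures S"
proof
  show "topspace (weak_topology S) \<subseteq> borel_prob_measures S"
    unfolding weak_topology_def topology_generated_by_topspace by (rule Union_least) auto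
  have "openin (weak_topology S) {M \<in> borel_prob_measures S. integral\<^sup>L M (\<lambda>_. 0::real) \<in> UNIV}"
    by (rule openin_weak_topology_basic) (auto simp: bounded_iff)
  then show "borel_prob_measures S \<subseteq> topspace (weak_topology S)"
    using openin_subset by fastforce
qed

lemma limitin_weak_topology:
  "limitin (weak_topology S) M N F \<longleftrightarrow>
     N \<in> borel_prob_measures S \<and> (\<forall>\<^sub>F i in F. M i \<in> borel_prob_measures S) \<and>
     (\<forall>f :: 'a::topological_space \<Rightarrow> real. continuous_on S f \<and> bounded (f ` S) \<longrightarrow>
        ((\<lambda>i. integral\<^sup>L (M i) f) \<longlongrightarrow> integral\<^sup>L N f) F)"
  (is "?L \<longleftrightarrow> ?R")
proof
  assume L: ?L
  have N: "N \<in> borel_prob_measures S"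
    using limitin_topspace[OF L] by (simp add: topspace_weak_topology)
  have ev: "\<forall>\<^sub>F i in F. M i \<in> borel_prob_measures S"
    using L openin_topspace[of "weak_topology S"]
    unfolding limitin_def topspace_weak_topology by simp
  have "((\<lambda>i. integral\<^sup>L (M i) f) \<longlongrightarrow> integral\<^sup>L N f) F"
    if f: "continuous_on S f" "bounded (f ` S)" for f :: "'a \<Rightarrow> real"
  proof (rule topological_tendstoI)
    fix U :: "real set" assume U: "open U" "integral\<^sup>L N f \<in> U"
    have "openin (weak_topology S) {M \<in> borel_prob_measures S. integral\<^sup>L M f \<in> U}"
      using f U by (intro openin_weak_topology_basic)
    moreover have "N \<in> {M \<in> borel_prob_measures S. integral\<^sup>L M f \<in> U}"
      using N U by simp
    ultimately have "\<forall>\<^sub>F i in F. M i \<in> {M \<in> borel_prob_measures S. integral\<^sup>L M f \<in> U}"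
      using L unfolding limitin_def by blast
    then show "\<forall>\<^sub>F i in F. integral\<^sup>L (M i) f \<in> U"
      by (rule eventually_mono) simp
  qed
  with N ev show ?R by blast
next
  assume R: ?R
  have "\<forall>\<^sub>F i in F. M i \<in> V" if "generate_topology_on
    {{M \<in> borel_prob_measures S. integral\<^sup>L M f \<in> U} | (f :: 'a \<Rightarrow> real) U.
      continuous_on S f \<and> bounded (f ` S) \<and> open U} V" "N \<in> V" for V
    using that
  proof (induction rule: generate_topology_on.induct)
    case Empty
    then show ?case by simp
  next
    case (Int A B)
    then show ?case by (simp add: eventually_conj_iff)
  next
    case (UN K)
    then obtain k where "k \<in> K" "N \<in> k" by blast
    then have "\<forall>\<^sub>F i in F. M i \<in> k" by (rule UN.IH)
    then show ?case by (rule eventually_mono) (use \<open>k \<in> K\<close> in blast)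
  next
    case (Basis s)
    from Basis.hyps obtain f :: "'a \<Rightarrow> real" and U where s: "s = {M \<in> borel_prob_measures S. integral\<^sup>L M f \<in> U}"
      and f: "continuous_on S f" "bounded (f ` S)" and U: "open U"
      by (elim CollectE exE conjE)
    have "((\<lambda>i. integral\<^sup>L (M i) f) \<longlongrightarrow> integral\<^sup>L N f) F"
      using R f by simp
    then have "\<forall>\<^sub>F i in F. integral\<^sup>L (M i) f \<in> U"
      by (rule topological_tendstoD) (use U Basis.prems s in simp_all)
    with R s show ?case by (simp add: eventually_conj_iff)
  qed
  then show ?L
    using R unfolding limitin_def topspace_weak_topology
    by (simp add: weak_topology_def openin_topology_generated_by_iff)
qed

end

theory Submission
  imports Defs "HOL-Real_Asymp.Real_Asymp"
begin

text \<open>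
  For \<open>p = (x\<^sub>0, y\<^sub>0)\<close> in the half plane and \<open>t > 0\<close>, a suitable parameter with \<open>a c - b\<^sup>2 = t\<^sup>2\<close> gives
  the Poincare density \<open>t / pi * exp (- t * q(p, z)) / y\<^sup>2\<close>, where \<open>q(p, z) = |z - p|\<^sup>2 / (y\<^sub>0 * y)\<close>
  depends only on the hyperbolic distance of \<open>p\<close> and \<open>z\<close>. On \<open>q \<ge> \<delta>\<close> it is at most
  \<open>t * exp (- (t - 1) * \<delta>)\<close> times the density for \<open>t = 1\<close>, which has total mass 1; hence these
  distributions tend weakly to the point mass at \<open>p\<close>, even when \<open>p\<close> moves along a convergent
  sequence as \<open>t\<close> tends to infinity. A probability distribution \<open>M\<close> is then approximated by
  discretising the identity map into simple functions \<open>s\<^sub>n\<close> and mixing the peaks at the values of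
  \<open>s\<^sub>n\<close> with the weights \<open>M(s\<^sub>n = p)\<close>; dominated convergence under \<open>M\<close> concludes.
\<close>

section \<open>Gaussian and inverse Gaussian integrals\<close>

text \<open>Oddness fixes the constant of integration: the half-line Gaussian integral then gives
  the limit at infinity, and reflection gives the other one.\<close>

lemma gaussian_primitive:
  obtains G :: "real \<Rightarrow> real" where "\<And>x. (G has_real_derivative exp (- x\<^sup>2)) (at x)"
    "(G \<longlongrightarrow> sqrt pi / 2) at_top" "(G \<longlongrightarrow> - (sqrt pi / 2)) at_bot"
proof -
  obtain F where F: "\<And>x. (F has_real_derivative exp (- x\<^sup>2)) (at x)"
    using einterval_antiderivative[of "-\<infinity>" \<infinity> "\<lambda>x::real. exp (- x\<^sup>2)"]
    by (auto simp: has_real_derivative_iff_has_vector_derivative)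
  \<comment> \<open>The odd part of \<open>F\<close> is again an antiderivative, as the integrand is
    even; it vanishes at 0, so \<open>G t\<close> is the integral over
    \<open>{0..t}\<close>.\<close>
  define G where "G x = (F x - F (- x)) / 2" for x
  have G: "(G has_real_derivative exp (- x\<^sup>2)) (at x)" for x
  proof -
    have "((\<lambda>x. F (- x)) has_real_derivative exp (- (- x)\<^sup>2) * (- 1)) (at x)"
      by (rule DERIV_chain2[OF F]) (auto intro!: derivative_eq_intros)
    then show ?thesis unfolding G_def
      by (auto intro!: derivative_eq_intros F)
  qed
  have odd: "G (- x) = - G x" for x by (simp add: G_def field_simps)
  have "((\<lambda>t. \<integral>x. indicator {..t} x *\<^sub>R (indicator {0..} x *\<^sub>R exp (- x\<^sup>2)) \<partial>lborel)
      \<longlongrightarrow> (\<integral>x. indicator {0..} x *\<^sub>R exp (- x\<^sup>2) \<partial>lborel)) (at_top :: real filter)"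
    by (rule tendsto_integral_at_top)
       (use gaussian_moment_0 in \<open>auto simp: has_bochner_integral_iff\<close>)
  moreover have "(\<integral>x. indicator {0..} x *\<^sub>R exp (- x\<^sup>2) \<partial>lborel) = sqrt pi / 2"
    using gaussian_moment_0 by (simp add: has_bochner_integral_iff)
  moreover have "(\<integral>x. indicator {..t} x *\<^sub>R (indicator {0..} x *\<^sub>R exp (- x\<^sup>2)) \<partial>lborel) = G t"
    if "t \<ge> 0" for t :: real
  proof -
    have "(\<integral>x. indicator {..t} x *\<^sub>R (indicator {0..} x *\<^sub>R exp (- x\<^sup>2)) \<partial>lborel)
        = (\<integral>x. indicator {0..t} x *\<^sub>R exp (- x\<^sup>2) \<partial>lborel)"
      by (intro Bochner_Integration.integral_cong) (auto split: split_indicator)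
    also have "\<dots> = G t - G 0"
      by (rule integral_FTC_atLeastAtMost[OF that])
         (auto simp flip: has_real_derivative_iff_has_vector_derivative
            intro!: continuous_intros DERIV_subset[OF G])
    finally show ?thesis by (simp add: G_def)
  qed
  ultimately have top: "(G \<longlongrightarrow> sqrt pi / 2) at_top"
    by (metis (mono_tags, lifting) Lim_transform_eventually eventually_at_top_linorderI)
  have "((\<lambda>x. - G (- x)) \<longlongrightarrow> - (sqrt pi / 2)) at_bot"
    by (intro tendsto_minus filterlim_compose[OF top] filterlim_uminus_at_top_at_bot)
  then have "(G \<longlongrightarrow> - (sqrt pi / 2)) at_bot" by (simp add: odd)
  with G top show thesis by (rule that)
qed

text \<open>
  With \<open>v, w = p * sqrt y \<mp> q / sqrt y\<close> one has \<open>v\<^sup>2 + 2 p q = w\<^sup>2 - 2 p q = p\<^sup>2 y + q\<^sup>2 / y\<close>, so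
  \<open>exp (- 2 p q) * G v - exp (2 p q) * G w\<close> is an explicit antiderivative.
\<close>

lemma nn_integral_inverse_gaussian:
  fixes p q :: real
  assumes p: "p > 0" and q: "q > 0"
  shows "(\<integral>\<^sup>+y. ennreal (q / (y * sqrt y) * exp (- (p\<^sup>2 * y + q\<^sup>2 / y))) * indicator {0<..} y \<partial>lborel)
    = ennreal (sqrt pi * exp (- 2 * p * q))"
proof -
  obtain G where G: "\<And>x. (G has_real_derivative exp (- x\<^sup>2)) (at x)"
    and top: "(G \<longlongrightarrow> sqrt pi / 2) at_top" and bot: "(G \<longlongrightarrow> - (sqrt pi / 2)) at_bot"
    by (rule gaussian_primitive) (blast intro: that)
  define v where "v y = p * sqrt y - q / sqrt y" for y
  define w where "w y = p * sqrt y + q / sqrt y" for y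
  define F where "F y = exp (- 2 * p * q) * G (v y) - exp (2 * p * q) * G (w y)" for y
  let ?f = "\<lambda>y. q / (y * sqrt y) * exp (- (p\<^sup>2 * y + q\<^sup>2 / y))"
  have F: "(F has_real_derivative ?f y) (at y)" if y: "y > 0" for y
  proof -
    have v: "(v has_real_derivative (p / sqrt y + q / (y * sqrt y)) / 2) (at y)"
      unfolding v_def using y
      by (auto intro!: derivative_eq_intros simp: field_simps)
    have w: "(w has_real_derivative (p / sqrt y - q / (y * sqrt y)) / 2) (at y)"
      unfolding w_def using y
      by (auto intro!: derivative_eq_intros simp: field_simps)
    have v2: "exp (- 2 * p * q) * exp (- (v y)\<^sup>2) = exp (- (p\<^sup>2 * y + q\<^sup>2 / y))"
      and w2: "exp (2 * p * q) * exp (- (w y)\<^sup>2) = exp (- (p\<^sup>2 * y + q\<^sup>2 / y))"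
      using y by (simp_all add: v_def w_def power2_diff power2_sum power_mult_distrib
          power_divide flip: exp_add)
    have "(F has_real_derivative
        exp (- 2 * p * q) * (exp (- (v y)\<^sup>2) * ((p / sqrt y + q / (y * sqrt y)) / 2))
        - exp (2 * p * q) * (exp (- (w y)\<^sup>2) * ((p / sqrt y - q / (y * sqrt y)) / 2))) (at y)"
      unfolding F_def by (intro DERIV_diff DERIV_cmult DERIV_chain2[OF G] v w)
    also have "exp (- 2 * p * q) * (exp (- (v y)\<^sup>2) * ((p / sqrt y + q / (y * sqrt y)) / 2))
        - exp (2 * p * q) * (exp (- (w y)\<^sup>2) * ((p / sqrt y - q / (y * sqrt y)) / 2)) = ?f y"
      unfolding mult.assoc[symmetric] v2 w2 by (simp add: field_simps)
    finally show ?thesis .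
  qed
  \<comment> \<open>\<open>v\<close> runs from minus to plus infinity, while \<open>w\<close> tends
    to plus infinity at both ends. In the difference of the boundary values of \<open>F\<close> the
    \<open>w\<close> terms therefore cancel, and only \<open>exp (- 2 * p * q)\<close> times the
    full Gaussian integral remains.\<close>
  have "filterlim v at_top at_top" "filterlim w at_top at_top"
    "filterlim v at_bot (at_right 0)" "filterlim w at_top (at_right 0)"
    unfolding v_def w_def using p q by real_asymp+
  note lim = this
  have A: "(F \<longlongrightarrow> exp (- 2 * p * q) * (- (sqrt pi / 2)) - exp (2 * p * q) * (sqrt pi / 2)) (at_right 0)"
    unfolding F_def using lim
    by (intro tendsto_intros filterlim_compose[OF top] filterlim_compose[OF bot])
  have B: "(F \<longlongrightarrow> exp (- 2 * p * q) * (sqrt pi / 2) - exp (2 * p * q) * (sqrt pi / 2)) at_top"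
    unfolding F_def using lim
    by (intro tendsto_intros filterlim_compose[OF top])
  note FTC = interval_integral_FTC_nonneg[where a = 0 and b = \<infinity> and F = F and f = ?f]
  have cont: "isCont ?f y" if "0 < ereal y" "ereal y < \<infinity>" for y
    using that by (auto intro!: continuous_intros)
  have deriv: "(F has_real_derivative ?f y) (at y)" if "0 < ereal y" "ereal y < \<infinity>" for y
    using that F by simp
  have nonneg: "AE y in lborel. 0 < ereal y \<longrightarrow> ereal y < \<infinity> \<longrightarrow> 0 \<le> ?f y"
    using q by (intro AE_I2) auto
  have A': "((F \<circ> real_of_ereal) \<longlongrightarrow>
      exp (- 2 * p * q) * (- (sqrt pi / 2)) - exp (2 * p * q) * (sqrt pi / 2)) (at_right 0)"
    unfolding zero_ereal_def ereal_tendsto_simps by (rule A)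
  have B': "((F \<circ> real_of_ereal) \<longlongrightarrow>
      exp (- 2 * p * q) * (sqrt pi / 2) - exp (2 * p * q) * (sqrt pi / 2)) (at_left \<infinity>)"
    unfolding ereal_tendsto_simps by (rule B)
  have int: "set_integrable lborel (einterval 0 \<infinity>) ?f"
    by (rule FTC(1)[OF _ deriv cont nonneg A' B']) simp_all
  have "(LBINT y=0..\<infinity>. ?f y) = exp (- 2 * p * q) * (sqrt pi / 2) - exp (2 * p * q) * (sqrt pi / 2)
      - (exp (- 2 * p * q) * (- (sqrt pi / 2)) - exp (2 * p * q) * (sqrt pi / 2))"
    by (rule FTC(2)[OF _ deriv cont nonneg A' B']) simp_all
  then have eq: "(LBINT y=0..\<infinity>. ?f y) = sqrt pi * exp (- 2 * p * q)"
    by (simp add: field_simps)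
  have [simp]: "einterval 0 \<infinity> = {0::real<..}" by (auto simp: einterval_def)
  have "(\<integral>\<^sup>+y. ennreal (?f y) * indicator {0<..} y \<partial>lborel)
      = (\<integral>\<^sup>+y. ennreal (indicator {0<..} y *\<^sub>R ?f y) \<partial>lborel)"
    by (intro nn_integral_cong) (auto split: split_indicator)
  also have "\<dots> = ennreal (\<integral>y. indicator {0<..} y *\<^sub>R ?f y \<partial>lborel)"
    by (rule nn_integral_eq_integral)
      (use int q in \<open>auto simp: set_integrable_def split: split_indicator\<close>)
  also have "(\<integral>y. indicator {0<..} y *\<^sub>R ?f y \<partial>lborel) = sqrt pi * exp (- 2 * p * q)"
    using eq by (simp add: interval_lebesgue_integral_def set_lebesgue_integral_def)
  finally show ?thesis .
qed


section \<open>Poincare densities have total mass 1\<close>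

lemma upper_half_plane_eq: "upper_half_plane = {z. 0 < snd z}"
  by (auto simp: upper_half_plane_def)

lemma open_upper_half_plane: "open upper_half_plane"
  unfolding upper_half_plane_eq by (intro open_Collect_less continuous_intros)

lemma upper_half_plane_borel [measurable]: "upper_half_plane \<in> sets borel"
  by (simp add: open_upper_half_plane)

text \<open>With entries a, b, c, the quadratic form takes the value a at (1, 0) and a (a c - b^2)
  at (-b, a); these two test vectors give both claims.\<close>

lemma sym_pos_def_entries:
  assumes "\<theta> \<in> sym_pos_def"
  shows "\<theta> $ 1 $ 1 > 0" "\<theta> $ 1 $ 1 * \<theta> $ 2 $ 2 - (\<theta> $ 1 $ 2)\<^sup>2 > 0"
proof -
  have sym: "\<theta> $ 2 $ 1 = \<theta> $ 1 $ 2"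
    using assms by (auto simp: sym_pos_def_def transpose_def vec_eq_iff)
  have pos: "v \<bullet> (\<theta> *v v) > 0" if "v \<noteq> 0" for v
    using assms that by (auto simp: sym_pos_def_def)
  have "(vector [1, 0] :: real^2) \<noteq> 0" by (simp add: vec_eq_iff forall_2)
  from pos[OF this] show a: "\<theta> $ 1 $ 1 > 0"
    by (simp add: inner_vec_def matrix_vector_mult_def sum_2)
  then have "(vector [- (\<theta> $ 1 $ 2), \<theta> $ 1 $ 1] :: real^2) \<noteq> 0"
    by (simp add: vec_eq_iff forall_2)
  from pos[OF this] have "\<theta> $ 1 $ 1 * (\<theta> $ 1 $ 1 * \<theta> $ 2 $ 2 - (\<theta> $ 1 $ 2)\<^sup>2) > 0"
    by (simp add: inner_vec_def matrix_vector_mult_def sum_2 sym algebra_simps power2_eq_square)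
  with a show "\<theta> $ 1 $ 1 * \<theta> $ 2 $ 2 - (\<theta> $ 1 $ 2)\<^sup>2 > 0"
    by (simp add: zero_less_mult_iff)
qed

lemma borel_measurable_poincare_density [measurable]:
  "poincare_density \<theta> \<in> borel_measurable borel"
  unfolding poincare_density_def Let_def split_beta' borel_prod[symmetric] by measurable

lemma poincare_density_nonneg:
  assumes "\<theta> \<in> sym_pos_def"
  shows "poincare_density \<theta> z \<ge> 0"
  using sym_pos_def_entries[OF assms] by (auto simp: poincare_density_def Let_def split_beta)

text \<open>Completing the square in x shows that for fixed y the density is a multiple of a normal
  density with mean -b/a and variance y/(2a). Integrating out x leaves the inverse Gaussian integral
  in y, whose value cancels the remaining constant.\<close>

lemma nn_integral_poincare_density:
  assumes "\<theta> \<in> sym_pos_def"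
  shows "(\<integral>\<^sup>+z. ennreal (poincare_density \<theta> z) \<partial>restrict_space lborel upper_half_plane) = 1"
proof -
  define a b c where "a = \<theta> $ 1 $ 1" and "b = \<theta> $ 1 $ 2" and "c = \<theta> $ 2 $ 2"
  define d where "d = sqrt (a * c - b\<^sup>2)"
  have a: "a > 0" and d: "d > 0" and d2: "d\<^sup>2 = a * c - b\<^sup>2"
    using sym_pos_def_entries[OF assms] by (auto simp: a_def b_def c_def d_def)
  \<comment> \<open>What completing the square leaves of the exponent is a y + (d^2/a)/y; its
    coefficients are \<open>p\<^sup>2\<close> and \<open>q\<^sup>2\<close>, and
    \<open>p * q = d\<close> matches the factor \<open>exp (2 * d)\<close>.\<close>
  define p q where "p = sqrt a" and "q = d / sqrt a"
  have pq: "p > 0" "q > 0" "p * q = d" "p\<^sup>2 = a" "q\<^sup>2 = d\<^sup>2 / a"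
    using a d by (auto simp: p_def q_def power_divide)
  define h where "h y = exp (2 * d) / sqrt pi * (q / (y * sqrt y) * exp (- (p\<^sup>2 * y + q\<^sup>2 / y)))" for y
  have eq: "poincare_density \<theta> (x, y) = h y * normal_density (- b / a) (sqrt (y / (2 * a))) x"
    if y: "y > 0" for x y
  proof -
    have c: "c = (d\<^sup>2 + b\<^sup>2) / a" using a d2 by (simp add: field_simps)
    have expo: "- ((a * (x\<^sup>2 + y\<^sup>2) + 2 * b * x + c) / y)
        = - (p\<^sup>2 * y + q\<^sup>2 / y) + - (x - - b / a)\<^sup>2 / (2 * (sqrt (y / (2 * a)))\<^sup>2)"
      using a y unfolding c by (simp add: pq divide_simps) (simp add: algebra_simps power2_eq_square)
    have factor: "d * exp (2 * d) / pi * (1 / y\<^sup>2)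
        = exp (2 * d) / sqrt pi * (q / (y * sqrt y)) * (1 / sqrt (2 * pi * (sqrt (y / (2 * a)))\<^sup>2))"
    proof -
      have "sqrt (2 * pi * (sqrt (y / (2 * a)))\<^sup>2) = sqrt pi * sqrt y / sqrt a"
        using a y by (simp add: real_sqrt_mult real_sqrt_divide)
      note sq = this
      have "sqrt pi * (sqrt pi * r) = pi * r" "sqrt y * (sqrt y * r) = y * r" for r
        using y by (simp_all flip: mult.assoc)
      then show ?thesis
        unfolding sq q_def using a y by (simp add: power2_eq_square divide_simps mult_ac)
    qed
    have "poincare_density \<theta> (x, y) = d * exp (2 * d) / pi * (1 / y\<^sup>2)
        * exp (- ((a * (x\<^sup>2 + y\<^sup>2) + 2 * b * x + c) / y))"
      by (simp add: poincare_density_def Let_def a_def b_def c_def d_def)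
    also have "\<dots> = h y * normal_density (- b / a) (sqrt (y / (2 * a))) x"
      unfolding expo factor exp_add h_def normal_density_def by (simp only: mult_ac)
    finally show ?thesis .
  qed
  have h_nonneg: "h y \<ge> 0" if "y > 0" for y
    using that pq by (simp add: h_def)
  have "(\<integral>\<^sup>+z. ennreal (poincare_density \<theta> z) \<partial>restrict_space lborel upper_half_plane)
      = (\<integral>\<^sup>+z. ennreal (poincare_density \<theta> z) * indicator upper_half_plane z \<partial>(lborel \<Otimes>\<^sub>M lborel))"
    by (subst nn_integral_restrict_space) (auto simp: lborel_prod)
  also have "\<dots> = (\<integral>\<^sup>+y. \<integral>\<^sup>+x. ennreal (poincare_density \<theta> (x, y)) * indicator upper_half_plane (x, y)
      \<partial>lborel \<partial>lborel)"
    by (subst lborel_pair.nn_integral_snd[symmetric]) (auto simp: lborel_prod)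
  also have "\<dots> = (\<integral>\<^sup>+y. ennreal (h y) * indicator {0<..} y \<partial>lborel)"
  proof (intro nn_integral_cong)
    fix y :: real
    show "(\<integral>\<^sup>+x. ennreal (poincare_density \<theta> (x, y)) * indicator upper_half_plane (x, y) \<partial>lborel)
        = ennreal (h y) * indicator {0<..} y"
    proof (cases "y > 0")
      case True
      have "(\<integral>\<^sup>+x. ennreal (poincare_density \<theta> (x, y)) * indicator upper_half_plane (x, y) \<partial>lborel)
          = (\<integral>\<^sup>+x. ennreal (h y) * ennreal (normal_density (- b / a) (sqrt (y / (2 * a))) x) \<partial>lborel)"
        using True by (intro nn_integral_cong)
          (simp add: eq upper_half_plane_eq h_nonneg ennreal_mult)
      also have "\<dots> = ennreal (h y) * (\<integral>\<^sup>+x. ennreal (normal_density (- b / a) (sqrt (y / (2 * a))) x) \<partial>lborel)"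
        by (rule nn_integral_cmult) simp
      also have "(\<integral>\<^sup>+x. ennreal (normal_density (- b / a) (sqrt (y / (2 * a))) x) \<partial>lborel) = 1"
        using True a by (subst nn_integral_eq_integral) auto
      finally show ?thesis using True by simp
    qed (simp add: upper_half_plane_eq)
  qed
  also have "\<dots> = (\<integral>\<^sup>+y. ennreal (exp (2 * d) / sqrt pi) *
      (ennreal (q / (y * sqrt y) * exp (- (p\<^sup>2 * y + q\<^sup>2 / y))) * indicator {0<..} y) \<partial>lborel)"
  proof -
    have "ennreal (h y) = ennreal (exp (2 * d) / sqrt pi) *
        ennreal (q / (y * sqrt y) * exp (- (p\<^sup>2 * y + q\<^sup>2 / y)))" for y
      unfolding h_def by (rule ennreal_mult') simp
    then show ?thesis by (simp only: mult.assoc)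
  qed
  also have "\<dots> = ennreal (exp (2 * d) / sqrt pi) * ennreal (sqrt pi * exp (- 2 * p * q))"
    unfolding nn_integral_inverse_gaussian[OF pq(1,2), symmetric]
    by (rule nn_integral_cmult) simp
  also have "\<dots> = 1"
    using pq by (simp add: mult.assoc flip: ennreal_mult exp_add)
  finally show ?thesis .
qed

lemma has_integral_poincare_density:
  assumes "\<theta> \<in> sym_pos_def"
  shows "has_bochner_integral (restrict_space lborel upper_half_plane) (poincare_density \<theta>) 1"
  by (rule has_bochner_integral_nn_integral)
    (use assms in \<open>auto simp: nn_integral_poincare_density poincare_density_nonneg intro: measurable_restrict_space1\<close>)

section \<open>Densities concentrating at a point\<close>

text \<open>For p = (x0, y0) the determinant is t^2, and a (x^2 + y^2) + 2 b x + c becomes (t/y0)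
  ((x - x0)^2 + y^2 + y0^2). Divided by y, this has its minimum 2t over the half plane at p.\<close>

definition peak_param :: "real \<Rightarrow> real \<times> real \<Rightarrow> real^2^2"
  where "peak_param t p = vector [vector [t / snd p, - (t * fst p / snd p)],
    vector [- (t * fst p / snd p), t * ((fst p)\<^sup>2 + (snd p)\<^sup>2) / snd p]]"

text \<open>On the half plane this is 2 (cosh d - 1), where d is the hyperbolic distance of the two
  points.\<close>

definition hyp_gap :: "real \<times> real \<Rightarrow> real \<times> real \<Rightarrow> real"
  where "hyp_gap p z = (dist z p)\<^sup>2 / (snd p * snd z)"

lemma peak_param_sym_pos_def:
  assumes t: "t > 0" and p: "p \<in> upper_half_plane"
  shows "peak_param t p \<in> sym_pos_def"
proof -
  obtain x y where xy: "p = (x, y)" "y > 0"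
    using p by (cases p) (auto simp: upper_half_plane_def)
  have "v \<bullet> (peak_param t p *v v) > 0" if "v \<noteq> 0" for v
  proof -
    have "v \<bullet> (peak_param t p *v v) = t / y * ((v $ 1 - x * v $ 2)\<^sup>2 + (y * v $ 2)\<^sup>2)"
      using xy by (simp add: inner_vec_def matrix_vector_mult_def sum_2 peak_param_def field_simps power2_eq_square)
    moreover have "(v $ 1 - x * v $ 2)\<^sup>2 + (y * v $ 2)\<^sup>2 > 0"
      using that xy by (auto simp: sum_power2_gt_zero_iff vec_eq_iff forall_2)
    ultimately show ?thesis using t xy by simp
  qed
  moreover have "transpose (peak_param t p) = peak_param t p"
    by (simp add: transpose_def vec_eq_iff forall_2 peak_param_def)
  ultimately show ?thesis by (simp add: sym_pos_def_def)
qed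

text \<open>The exponent of the density is -2t minus t times the gap, and the normalising factor exp
  (2t) absorbs the constant.\<close>

lemma poincare_density_peak:
  assumes t: "t > 0" and p: "p \<in> upper_half_plane" and z: "z \<in> upper_half_plane"
  shows "poincare_density (peak_param t p) z = t / pi * exp (- (t * hyp_gap p z)) / (snd z)\<^sup>2"
proof -
  obtain x y where xy: "p = (x, y)" "y > 0"
    using p by (cases p) (auto simp: upper_half_plane_def)
  obtain u v where uv: "z = (u, v)" "v > 0"
    using z by (cases z) (auto simp: upper_half_plane_def)
  have "t / y * (t * (x\<^sup>2 + y\<^sup>2) / y) - (- (t * x / y))\<^sup>2 = t\<^sup>2"
    using xy by (simp add: field_simps power2_eq_square)
  then have d: "sqrt (t / y * (t * (x\<^sup>2 + y\<^sup>2) / y) - (- (t * x / y))\<^sup>2) = t"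
    using t by simp
  have "2 * t - (t / y * (u\<^sup>2 + v\<^sup>2) + 2 * (- (t * x / y)) * u + t * (x\<^sup>2 + y\<^sup>2) / y) / v
      = - (t * hyp_gap p z)"
    using xy uv by (simp add: hyp_gap_def dist_Pair_Pair dist_real_def)
      (simp add: field_simps power2_eq_square)
  then have "exp (2 * t) * exp (- ((t / y * (u\<^sup>2 + v\<^sup>2) + 2 * (- (t * x / y)) * u + t * (x\<^sup>2 + y\<^sup>2) / y) / v))
      = exp (- (t * hyp_gap p z))"
    by (simp flip: exp_add)
  note expo = this
  have "poincare_density (peak_param t p) z = t / pi * (exp (2 * t)
      * exp (- ((t / y * (u\<^sup>2 + v\<^sup>2) + 2 * (- (t * x / y)) * u + t * (x\<^sup>2 + y\<^sup>2) / y) / v))) / v\<^sup>2"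
    unfolding xy uv poincare_density_def peak_param_def Let_def prod.case vector_2 fst_conv snd_conv d
    by simp
  then show ?thesis unfolding expo by (simp add: uv)
qed

text \<open>Passes from a small hyperbolic gap to a small Euclidean distance, uniformly over centres
  of height at most \<open>Y\<close>. If the distance is r, then \<open>z\<close> has height at most
  Y + r, so the gap is at least r^2 / (Y (Y + r)), which increases with r.\<close>

lemma dist_less_if_hyp_gap_less:
  assumes "w \<in> upper_half_plane" "z \<in> upper_half_plane" "snd w \<le> Y" "\<eta> > 0"
    and gap: "hyp_gap w z < \<eta>\<^sup>2 / (Y * (Y + \<eta>))"
  shows "dist z w < \<eta>"
proof (rule ccontr)
  let ?r = "dist z w"
  assume "\<not> ?r < \<eta>"
  then have r: "\<eta> \<le> ?r" by simp
  have w: "snd w > 0" and z: "snd z > 0" and Y: "Y > 0"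
    using assms by (auto simp: upper_half_plane_eq)
  have "snd z \<le> snd w + ?r"
    using dist_snd_le[of z w] by (auto simp: dist_real_def)
  then have "snd w * snd z \<le> Y * (Y + ?r)"
    using assms w z by (intro mult_mono) auto
  \<comment> \<open>Monotonicity of r^2 / (Y + r) in r, with denominators cleared.\<close>
  moreover have "\<eta>\<^sup>2 * (Y + ?r) \<le> ?r\<^sup>2 * (Y + \<eta>)"
  proof -
    have "\<eta>\<^sup>2 * Y \<le> ?r\<^sup>2 * Y"
      using r assms Y by (intro mult_right_mono power_mono) auto
    moreover have "\<eta>\<^sup>2 * ?r \<le> ?r\<^sup>2 * \<eta>"
      using mult_right_mono[OF r, of "\<eta> * ?r"] assms by (simp add: power2_eq_square mult_ac)
    ultimately show ?thesis by (simp add: algebra_simps)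
  qed
  ultimately have "\<eta>\<^sup>2 * (snd w * snd z) \<le> ?r\<^sup>2 * (Y * (Y + \<eta>))"
    by (smt (verit, ccfv_SIG) Y mult.left_commute mult_left_mono zero_le_power2)
  moreover have "?r\<^sup>2 * (Y * (Y + \<eta>)) < \<eta>\<^sup>2 * (snd w * snd z)"
    using gap w z Y assms by (simp add: hyp_gap_def divide_simps)
  ultimately show False by simp
qed

lemma space_restrict_upper_half_plane [simp]:
  "space (restrict_space lborel upper_half_plane) = upper_half_plane"
  by (simp add: space_restrict_space)

lemma borel_measurable_restrict_upper_half_plane:
  fixes f :: "real \<times> real \<Rightarrow> real"
  assumes "continuous_on upper_half_plane f"
  shows "f \<in> borel_measurable (restrict_space lborel upper_half_plane)"
  unfolding measurable_cong_sets[OF sets_restrict_space_cong[OF sets_lborel] refl]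
  by (rule borel_measurable_continuous_on_restrict[OF assms])

lemma integrable_poincare_density_mult:
  fixes f :: "real \<times> real \<Rightarrow> real"
  assumes "\<theta> \<in> sym_pos_def" "f \<in> borel_measurable (restrict_space lborel upper_half_plane)"
    and C: "\<And>z. z \<in> upper_half_plane \<Longrightarrow> \<bar>f z\<bar> \<le> C"
  shows "integrable (restrict_space lborel upper_half_plane) (\<lambda>z. poincare_density \<theta> z * f z)"
proof (rule Bochner_Integration.integrable_bound)
  let ?R = "restrict_space lborel upper_half_plane"
  show "integrable ?R (\<lambda>z. poincare_density \<theta> z * C)"
    using has_integral_poincare_density[OF assms(1)] by (simp add: has_bochner_integral_iff)
  show "(\<lambda>z. poincare_density \<theta> z * f z) \<in> borel_measurable ?R"
    by (intro borel_measurable_times assms(2) measurable_restrict_space1) simp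
  show "AE z in ?R. norm (poincare_density \<theta> z * f z) \<le> norm (poincare_density \<theta> z * C)"
  proof (intro AE_I2)
    fix z assume "z \<in> space ?R"
    then have "\<bar>f z\<bar> \<le> \<bar>C\<bar>" using C[of z] by simp
    then show "norm (poincare_density \<theta> z * f z) \<le> norm (poincare_density \<theta> z * C)"
      by (simp add: abs_mult mult_left_mono)
  qed
qed

text \<open>The centres may move with \<open>n\<close> because the discretised identity will supply
  a different centre at each stage. Near the centre, continuity of \<open>f\<close> at
  \<open>p\<close> controls the error; far away, comparison with the density for t = 1 does. The
  parameter \<open>real n + 1\<close> is positive also at \<open>n = 0\<close>.\<close>

lemma integral_peak_tendsto:
  fixes f :: "real \<times> real \<Rightarrow> real"
  assumes cont: "continuous_on upper_half_plane f"
    and C: "\<And>z. z \<in> upper_half_plane \<Longrightarrow> \<bar>f z\<bar> \<le> C"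
    and p: "p \<in> upper_half_plane" and s: "\<And>n. s n \<in> upper_half_plane" "s \<longlonglongrightarrow> p"
  shows "(\<lambda>n. \<integral>z. poincare_density (peak_param (real n + 1) (s n)) z * f z
      \<partial>restrict_space lborel upper_half_plane) \<longlonglongrightarrow> f p"
proof (rule tendstoI)
  let ?R = "restrict_space lborel upper_half_plane"
  fix \<epsilon> :: real assume "\<epsilon> > 0"
  then have "\<epsilon> / 2 > 0" by simp
  with cont p obtain \<eta> where \<eta>: "\<eta> > 0"
    "\<And>z. z \<in> upper_half_plane \<Longrightarrow> dist z p < \<eta> \<Longrightarrow> \<bar>f z - f p\<bar> < \<epsilon> / 2"
    unfolding continuous_on_iff dist_real_def by metis
  \<comment> \<open>Any bound above \<open>snd p\<close> would do: the heights of \<open>s n\<close>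
    are eventually below it.\<close>
  define Y where "Y = 2 * snd p"
  have Y: "Y > 0" using p by (simp add: Y_def upper_half_plane_eq)
  \<comment> \<open>The gap threshold that forces \<open>dist z (s n) < \<eta> / 2\<close>; the
    other half of \<open>\<eta>\<close> is spent on the distance from \<open>s n\<close> to
    \<open>p\<close>.\<close>
  define \<delta> where "\<delta> = (\<eta> / 2)\<^sup>2 / (Y * (Y + \<eta> / 2))"
  have \<delta>: "\<delta> > 0" using \<eta> Y by (simp add: \<delta>_def)
  have "C \<ge> 0" using C[OF p] by simp
  have "\<forall>\<^sub>F n in sequentially. dist (s n) p < \<eta> / 2"
    using s(2) \<eta> by (intro tendstoD) auto
  moreover have "\<forall>\<^sub>F n in sequentially. snd (s n) < Y"
    using p by (intro order_tendstoD(2)[OF tendsto_snd[OF s(2)]]) (simp add: Y_def upper_half_plane_eq)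
  \<comment> \<open>The far contribution: \<open>2 * C\<close> bounds the oscillation of
    \<open>f\<close>, and the exponential beats the linear factor.\<close>
  moreover have "(\<lambda>n. 2 * C * ((real n + 1) * exp (- (real n * \<delta>)))) \<longlonglongrightarrow> 2 * C * 0"
    by (intro tendsto_mult tendsto_const) (use \<delta> in real_asymp)
  then have "\<forall>\<^sub>F n in sequentially. 2 * C * ((real n + 1) * exp (- (real n * \<delta>))) < \<epsilon> / 2"
    using \<open>\<epsilon> > 0\<close> by (intro order_tendstoD(2)) auto
  ultimately show "\<forall>\<^sub>F n in sequentially.
      dist (\<integral>z. poincare_density (peak_param (real n + 1) (s n)) z * f z \<partial>?R) (f p) < \<epsilon>"
  proof eventually_elim
    case (elim n)
    let ?K = "poincare_density (peak_param (real n + 1) (s n))"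
    let ?K1 = "poincare_density (peak_param 1 (s n))"
    let ?B = "2 * C * ((real n + 1) * exp (- (real n * \<delta>)))"
    have spd: "peak_param (real n + 1) (s n) \<in> sym_pos_def" "peak_param 1 (s n) \<in> sym_pos_def"
      using s(1) by (auto intro!: peak_param_sym_pos_def)
    note K = has_integral_poincare_density[OF spd(1)]
    note K1 = has_integral_poincare_density[OF spd(2)]
    have f: "f \<in> borel_measurable ?R"
      by (rule borel_measurable_restrict_upper_half_plane[OF cont])
    have intf: "integrable ?R (\<lambda>z. ?K z * f z)"
      by (rule integrable_poincare_density_mult[OF spd(1) f C])
    have diff: "\<bar>f z - f p\<bar> \<le> 2 * C" if "z \<in> upper_half_plane" for z
      using C[OF that] C[OF p] by linarith
    have intd: "integrable ?R (\<lambda>z. ?K z * \<bar>f z - f p\<bar>)"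
      by (rule integrable_poincare_density_mult[OF spd(1)]) (use f diff in auto)
    \<comment> \<open>Since \<open>?K\<close> has mass 1, \<open>f p\<close> can be moved under the
      integral.\<close>
    have "\<bar>(\<integral>z. ?K z * f z \<partial>?R) - f p\<bar> = \<bar>\<integral>z. ?K z * (f z - f p) \<partial>?R\<bar>"
      using K intf by (simp add: right_diff_distrib has_bochner_integral_iff)
    also have "\<dots> \<le> (\<integral>z. \<bar>?K z * (f z - f p)\<bar> \<partial>?R)"
      by (rule integral_abs_bound)
    also have "\<dots> = (\<integral>z. ?K z * \<bar>f z - f p\<bar> \<partial>?R)"
      using poincare_density_nonneg[OF spd(1)] by (simp add: abs_mult)
    \<comment> \<open>The first summand dominates where the gap is below \<open>\<delta>\<close>,
      the second elsewhere. Adding both gives a single bound on the whole half plane, and each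
      density integrates to 1.\<close>
    also have "\<dots> \<le> (\<integral>z. \<epsilon> / 2 * ?K z + ?B * ?K1 z \<partial>?R)"
    proof (rule integral_mono[OF intd])
      show "integrable ?R (\<lambda>z. \<epsilon> / 2 * ?K z + ?B * ?K1 z)"
        using K K1 by (simp add: has_bochner_integral_iff)
      fix z assume "z \<in> space ?R"
      then have z: "z \<in> upper_half_plane" by simp
      have nn: "?K z \<ge> 0" "?K1 z \<ge> 0" using poincare_density_nonneg spd by auto
      show "?K z * \<bar>f z - f p\<bar> \<le> \<epsilon> / 2 * ?K z + ?B * ?K1 z"
      proof (cases "hyp_gap (s n) z < \<delta>")
        case True
        then have "dist z (s n) < \<eta> / 2"
          using \<eta>(1) elim(2) unfolding \<delta>_def
          by (intro dist_less_if_hyp_gap_less[OF s(1) z, of n Y]) auto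
        then have "dist z p < \<eta>"
          using elim dist_triangle[of z p "s n"] by (simp add: dist_commute)
        then have "?K z * \<bar>f z - f p\<bar> \<le> ?K z * (\<epsilon> / 2)"
          using \<eta>(2)[OF z] nn by (intro mult_left_mono) auto
        then show ?thesis using nn \<open>C \<ge> 0\<close> by (simp add: add_increasing2 mult.commute)
      next
        case False
        \<comment> \<open>With t = n + 1, one unit of t in the exponent is kept for
          \<open>?K1\<close>; the other n units give the decay.\<close>
        have "?K z = (real n + 1) * exp (- (real n * hyp_gap (s n) z)) * ?K1 z"
          using s(1) z by (simp add: poincare_density_peak algebra_simps add_divide_distrib flip: exp_add)
        also have "\<dots> \<le> (real n + 1) * exp (- (real n * \<delta>)) * ?K1 z"
          using False nn by (intro mult_right_mono mult_left_mono) (auto intro: mult_left_mono)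
        finally have "?K z * \<bar>f z - f p\<bar> \<le> (real n + 1) * exp (- (real n * \<delta>)) * ?K1 z * (2 * C)"
          using diff[OF z] nn by (intro mult_mono) auto
        then show ?thesis using nn \<open>\<epsilon> > 0\<close> by (simp add: add_increasing mult_ac)
      qed
    qed
    also have "\<dots> = \<epsilon> / 2 + ?B"
      using K K1 by (simp add: has_bochner_integral_iff)
    finally show ?case using elim by (simp add: dist_real_def)
  qed
qed

section \<open>Finite mixtures and integration against them\<close>

lemma mixture_density_nonneg:
  assumes "\<forall>i\<in>{1..n}. \<theta> i \<in> sym_pos_def" "\<forall>i\<in>{1..n}. w i \<ge> 0"
  shows "(\<Sum>i=1..n. w i * poincare_density (\<theta> i) z) \<ge> 0"
  using assms by (auto intro!: sum_nonneg mult_nonneg_nonneg poincare_density_nonneg)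

lemma borel_measurable_mixture_density:
  "(\<lambda>z. \<Sum>i=1..n. w i * poincare_density (\<theta> i) z)
    \<in> borel_measurable (restrict_space lborel upper_half_plane)"
  by (rule measurable_restrict_space1) simp

lemma poincare_mixtures_subset: "poincare_mixtures \<subseteq> borel_prob_measures upper_half_plane"
proof
  fix N assume "N \<in> poincare_mixtures"
  then obtain n w \<theta> where N: "N = poincare_mixture n w \<theta>"
    and \<theta>: "\<forall>i\<in>{1..n}. \<theta> i \<in> sym_pos_def" and w: "\<forall>i\<in>{1..n}. w i \<ge> 0"
    and sum: "(\<Sum>i=1..n. w i) = 1"
    by (auto simp: poincare_mixtures_def)
  let ?R = "restrict_space lborel upper_half_plane"
  let ?g = "\<lambda>z. \<Sum>i=1..n. w i * poincare_density (\<theta> i) z"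
  have "has_bochner_integral ?R ?g (\<Sum>i=1..n. w i * 1)"
    using \<theta> by (intro has_bochner_integral_sum has_bochner_integral_mult_right has_integral_poincare_density) auto
  then have "(\<integral>\<^sup>+z. ennreal (?g z) \<partial>?R) = ennreal 1"
    using mixture_density_nonneg[OF \<theta> w] sum
    by (subst nn_integral_eq_integral) (auto simp: has_bochner_integral_iff)
  moreover have "emeasure N (space N) = (\<integral>\<^sup>+z. ennreal (?g z) * indicator (space ?R) z \<partial>?R)"
    unfolding N poincare_mixture_def space_density
    using borel_measurable_mixture_density[of w \<theta> n] by (intro emeasure_density sets.top) auto
  moreover have "\<dots> = (\<integral>\<^sup>+z. ennreal (?g z) \<partial>?R)"
    by (intro nn_integral_cong) simp
  ultimately have "emeasure N (space N) = 1" by simp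
  moreover have "sets N = sets (restrict_space borel upper_half_plane)"
    by (simp add: N poincare_mixture_def sets_restrict_space)
  ultimately show "N \<in> borel_prob_measures upper_half_plane"
    by (auto simp: borel_prob_measures_def intro: prob_spaceI)
qed

lemma integral_poincare_mixture:
  fixes f :: "real \<times> real \<Rightarrow> real"
  assumes \<theta>: "\<forall>i\<in>{1..n}. \<theta> i \<in> sym_pos_def" and w: "\<forall>i\<in>{1..n}. w i \<ge> 0"
    and f: "f \<in> borel_measurable (restrict_space lborel upper_half_plane)"
    and C: "\<And>z. z \<in> upper_half_plane \<Longrightarrow> \<bar>f z\<bar> \<le> C"
  shows "integral\<^sup>L (poincare_mixture n w \<theta>) f =
    (\<Sum>i=1..n. w i * (\<integral>z. poincare_density (\<theta> i) z * f z \<partial>restrict_space lborel upper_half_plane))"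
proof -
  let ?R = "restrict_space lborel upper_half_plane"
  have "integral\<^sup>L (poincare_mixture n w \<theta>) f
      = (\<integral>z. (\<Sum>i=1..n. w i * poincare_density (\<theta> i) z) *\<^sub>R f z \<partial>?R)"
    unfolding poincare_mixture_def using mixture_density_nonneg[OF \<theta> w]
    by (intro integral_density[OF f borel_measurable_mixture_density]) auto
  also have "\<dots> = (\<integral>z. (\<Sum>i=1..n. w i * (poincare_density (\<theta> i) z * f z)) \<partial>?R)"
    by (simp add: sum_distrib_right mult.assoc)
  also have "\<dots> = (\<Sum>i=1..n. w i * (\<integral>z. poincare_density (\<theta> i) z * f z \<partial>?R))"
    using integrable_poincare_density_mult[OF _ f C] \<theta>
    by (subst Bochner_Integration.integral_sum) auto
  finally show ?thesis .
qed

text \<open>The level sets of \<open>s\<close> partition the space, so \<open>g\<close> enters only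
  through finitely many values. This makes the formula applicable to a peak integral as a function
  of its centre.\<close>

lemma (in finite_measure) integral_comp_simple_function:
  fixes g :: "'b \<Rightarrow> real"
  assumes s: "simple_function M s"
  shows "(\<integral>z. g (s z) \<partial>M) = (\<Sum>p\<in>s ` space M. measure M (s -` {p} \<inter> space M) * g p)"
proof -
  have fin: "finite (s ` space M)" and sets: "s -` {p} \<inter> space M \<in> sets M" for p
    using s by (auto dest: simple_functionD)
  have "(\<integral>z. g (s z) \<partial>M) = (\<integral>z. (\<Sum>p\<in>s ` space M. indicator (s -` {p} \<inter> space M) z * g p) \<partial>M)"
  proof (intro Bochner_Integration.integral_cong refl)
    fix z assume z: "z \<in> space M"
    have "(\<Sum>p\<in>s ` space M. indicator (s -` {p} \<inter> space M) z * g p)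
        = (\<Sum>p\<in>s ` space M. if p = s z then g p else 0)"
      using z by (intro sum.cong) (auto split: split_indicator)
    then show "g (s z) = (\<Sum>p\<in>s ` space M. indicator (s -` {p} \<inter> space M) z * g p)"
      using fin z by simp
  qed
  also have "\<dots> = (\<Sum>p\<in>s ` space M. measure M (s -` {p} \<inter> space M) * g p)"
    using sets by (subst Bochner_Integration.integral_sum) (auto simp: emeasure_eq_measure)
  finally show ?thesis .
qed

text \<open>The mixture puts weight M(s = p) on the peak at each value p of \<open>s\<close>, so
  integrating against it averages the peak integrals over \<open>M\<close>. One mixture serves all
  test functions at once.\<close>

lemma ex_mixture_of_peaks:
  assumes M: "prob_space M" and s: "simple_function M s"
    and H: "\<And>z. z \<in> space M \<Longrightarrow> s z \<in> upper_half_plane" and t: "t > 0"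
  shows "\<exists>N\<in>poincare_mixtures. \<forall>f :: real \<times> real \<Rightarrow> real.
    continuous_on upper_half_plane f \<and> bounded (f ` upper_half_plane) \<longrightarrow>
    integral\<^sup>L N f = (\<integral>z. (\<integral>u. poincare_density (peak_param t (s z)) u * f u
      \<partial>restrict_space lborel upper_half_plane) \<partial>M)"
proof -
  interpret prob_space M by fact
  let ?R = "restrict_space lborel upper_half_plane"
  let ?P = "s ` space M"
  have "finite ?P" using s by (rule simple_functionD)
  then obtain h where h: "bij_betw h {1..card ?P} ?P"
    using ex_bij_betw_nat_finite_1 by blast
  define w where "w i = prob (s -` {h i} \<inter> space M)" for i
  define \<theta> where "\<theta> i = peak_param t (h i)" for i
  \<comment> \<open>Used twice: with g = 1 for the total weight, and with g the peak integral of a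
    test function.\<close>
  have sum: "(\<Sum>i=1..card ?P. w i * g (h i)) = (\<integral>z. g (s z) \<partial>M)" for g :: "_ \<Rightarrow> real"
    unfolding integral_comp_simple_function[OF s] w_def by (rule sum.reindex_bij_betw[OF h])
  have \<theta>: "\<forall>i\<in>{1..card ?P}. \<theta> i \<in> sym_pos_def"
    using bij_betwE[OF h] H t unfolding \<theta>_def by (auto intro!: peak_param_sym_pos_def)
  have w: "\<forall>i\<in>{1..card ?P}. w i \<ge> 0" by (simp add: w_def)
  have "card ?P \<ge> 1"
    using \<open>finite ?P\<close> not_empty by (simp add: Suc_le_eq card_gt_0_iff)
  moreover have "(\<Sum>i=1..card ?P. w i) = 1"
    using sum[of "\<lambda>_. 1"] prob_space by simp
  ultimately have "poincare_mixture (card ?P) w \<theta> \<in> poincare_mixtures"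
    using \<theta> w unfolding poincare_mixtures_def by blast
  moreover have "integral\<^sup>L (poincare_mixture (card ?P) w \<theta>) f
      = (\<integral>z. (\<integral>u. poincare_density (peak_param t (s z)) u * f u \<partial>?R) \<partial>M)"
    if f: "continuous_on upper_half_plane f" "bounded (f ` upper_half_plane)" for f :: "_ \<Rightarrow> real"
  proof -
    from f(2) obtain C where "\<And>z. z \<in> upper_half_plane \<Longrightarrow> \<bar>f z\<bar> \<le> C"
      by (auto simp: bounded_iff)
    note integral_poincare_mixture[OF \<theta> w borel_measurable_restrict_upper_half_plane[OF f(1)] this]
    also have "(\<Sum>i=1..card ?P. w i * (\<integral>u. poincare_density (\<theta> i) u * f u \<partial>?R))
        = (\<integral>z. (\<integral>u. poincare_density (peak_param t (s z)) u * f u \<partial>?R) \<partial>M)"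
      unfolding \<theta>_def by (rule sum)
    finally show ?thesis .
  qed
  ultimately show ?thesis by blast
qed

section \<open>Discretisation of the identity and weak density\<close>

text \<open>Simple functions converging to the identity may take values outside \<open>S\<close>.
  Redirecting those to a fixed point of \<open>S\<close> keeps the limit, because \<open>S\<close>
  is open and the values at each point of \<open>S\<close> eventually lie in it.\<close>

lemma borel_prob_measure_approx_id:
  fixes M :: "'a::{metric_space, second_countable_topology} measure"
  assumes M: "M \<in> borel_prob_measures S" and S: "open S"
  obtains s where "\<And>n. simple_function M (s n)" "\<And>n z. z \<in> S \<Longrightarrow> s n z \<in> S"
    "\<And>z. z \<in> S \<Longrightarrow> (\<lambda>n. s n z) \<longlonglongrightarrow> z"
proof -
  interpret prob_space M using M by (simp add: borel_prob_measures_def)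
  have sets: "sets M = sets (restrict_space borel S)"
    using M by (simp add: borel_prob_measures_def)
  have space: "space M = S"
    using sets_eq_imp_space_eq[OF sets] by (simp add: space_restrict_space)
  obtain z0 where z0: "z0 \<in> S" using not_empty space by auto
  have "(\<lambda>z. z) \<in> borel_measurable M"
    unfolding measurable_cong_sets[OF sets refl] by (rule measurable_restrict_space1) simp
  from borel_measurable_implies_sequence_metric[OF this]
  obtain F where F: "\<And>n. simple_function M (F n)" "\<And>z. z \<in> S \<Longrightarrow> (\<lambda>n. F n z) \<longlonglongrightarrow> z"
    unfolding space by blast
  define s where "s n z = (if F n z \<in> S then F n z else z0)" for n z
  have "simple_function M (s n)" for n
    using simple_function_compose[OF F(1)[of n], of "\<lambda>y. if y \<in> S then y else z0"]
    by (simp add: s_def[abs_def] comp_def)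
  moreover have "(\<lambda>n. s n z) \<longlonglongrightarrow> z" if z: "z \<in> S" for z
  proof -
    have "\<forall>\<^sub>F n in sequentially. F n z \<in> S"
      using topological_tendstoD[OF F(2)[OF z] S z] .
    then have "\<forall>\<^sub>F n in sequentially. F n z = s n z"
      by eventually_elim (simp add: s_def)
    with F(2)[OF z] show ?thesis by (rule Lim_transform_eventually)
  qed
  moreover have "s n z \<in> S" for n z
    using z0 by (simp add: s_def)
  ultimately show thesis by (intro that)
qed

theorem corollary2:
  shows "poincare_mixtures \<subseteq> topspace (weak_topology upper_half_plane) \<and>
    weak_topology upper_half_plane closure_of poincare_mixtures =
      topspace (weak_topology upper_half_plane)"
proof (intro conjI equalityI closure_of_subset_topspace)
  show "poincare_mixtures \<subseteq> topspace (weak_topology upper_half_plane)"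
    unfolding topspace_weak_topology by (rule poincare_mixtures_subset)
  let ?H = upper_half_plane
  let ?R = "restrict_space lborel ?H"
  show "topspace (weak_topology ?H) \<subseteq> weak_topology ?H closure_of poincare_mixtures"
  proof
    fix M assume "M \<in> topspace (weak_topology ?H)"
    then have M: "M \<in> borel_prob_measures ?H" by (simp add: topspace_weak_topology)
    then interpret prob_space M by (simp add: borel_prob_measures_def)
    have sets: "sets M = sets (restrict_space borel ?H)"
      using M by (simp add: borel_prob_measures_def)
    have space: "space M = ?H"
      using sets_eq_imp_space_eq[OF sets] by (simp add: space_restrict_space)
    obtain s where s: "\<And>n. simple_function M (s n)" "\<And>n z. z \<in> ?H \<Longrightarrow> s n z \<in> ?H"
      "\<And>z. z \<in> ?H \<Longrightarrow> (\<lambda>n. s n z) \<longlonglongrightarrow> z"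
      using borel_prob_measure_approx_id[OF M open_upper_half_plane] by blast
    define I where "I f n p = (\<integral>u. poincare_density (peak_param (real n + 1) p) u * f u \<partial>?R)"
      for f :: "_ \<Rightarrow> real" and n p
    \<comment> \<open>The quantifier over \<open>f\<close> stays inside, so that the chosen sequence
      of mixtures does not depend on the test function.\<close>
    have "\<forall>n. \<exists>N\<in>poincare_mixtures. \<forall>f. continuous_on ?H f \<and> bounded (f ` ?H) \<longrightarrow>
        integral\<^sup>L N f = (\<integral>z. I f n (s n z) \<partial>M)"
      unfolding I_def using s(2)
      by (intro allI ex_mixture_of_peaks prob_space_axioms s(1)) (auto simp: space)
    then obtain N where N: "\<And>n. N n \<in> poincare_mixtures"
      and int_N: "\<And>n f. continuous_on ?H f \<Longrightarrow> bounded (f ` ?H) \<Longrightarrow>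
        integral\<^sup>L (N n) f = (\<integral>z. I f n (s n z) \<partial>M)"
      by metis
    have "(\<lambda>n. integral\<^sup>L (N n) f) \<longlonglongrightarrow> integral\<^sup>L M f"
      if f: "continuous_on ?H f" "bounded (f ` ?H)" for f :: "_ \<Rightarrow> real"
    proof -
      from f(2) obtain C where C: "\<And>z. z \<in> ?H \<Longrightarrow> \<bar>f z\<bar> \<le> C"
        by (auto simp: bounded_iff)
      \<comment> \<open>Averaging against a probability density preserves the bound
        \<open>C\<close>, so the constant \<open>C\<close> can serve as the dominating function,
        integrable because \<open>M\<close> is finite.\<close>
      have bound: "\<bar>I f n p\<bar> \<le> C" if p: "p \<in> ?H" for n p
      proof -
        have spd: "peak_param (real n + 1) p \<in> sym_pos_def"
          using p by (intro peak_param_sym_pos_def) auto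
        let ?K = "poincare_density (peak_param (real n + 1) p)"
        note K = has_integral_poincare_density[OF spd]
        have "\<bar>I f n p\<bar> \<le> (\<integral>u. \<bar>?K u * f u\<bar> \<partial>?R)"
          unfolding I_def by (rule integral_abs_bound)
        also have "\<dots> \<le> (\<integral>u. ?K u * C \<partial>?R)"
        proof (rule integral_mono)
          show "integrable ?R (\<lambda>u. \<bar>?K u * f u\<bar>)"
            using integrable_poincare_density_mult[OF spd
                borel_measurable_restrict_upper_half_plane[OF f(1)] C] by simp
          show "integrable ?R (\<lambda>u. ?K u * C)"
            using K by (simp add: has_bochner_integral_iff)
          show "\<bar>?K u * f u\<bar> \<le> ?K u * C" if "u \<in> space ?R" for u
            using that C poincare_density_nonneg[OF spd] by (simp add: abs_mult mult_left_mono)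
        qed
        also have "\<dots> = C" using K by (simp add: has_bochner_integral_iff)
        finally show ?thesis .
      qed
      have "(\<lambda>n. \<integral>z. I f n (s n z) \<partial>M) \<longlonglongrightarrow> integral\<^sup>L M f"
      proof (rule integral_dominated_convergence)
        show "f \<in> borel_measurable M"
          unfolding measurable_cong_sets[OF sets refl]
          by (rule borel_measurable_continuous_on_restrict[OF f(1)])
        \<comment> \<open>Composed with a simple function, \<open>I f n\<close> is again simple,
          hence measurable.\<close>
        show "(\<lambda>z. I f n (s n z)) \<in> borel_measurable M" for n
          using simple_function_compose[OF s(1)[of n], of "I f n"]
          by (auto simp: comp_def intro: borel_measurable_simple_function)
        \<comment> \<open>For each fixed z the centres \<open>s n z\<close> tend to z while the
          parameter tends to infinity: the case of moving centres.\<close>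
        show "AE z in M. (\<lambda>n. I f n (s n z)) \<longlonglongrightarrow> f z"
          unfolding I_def using s(2,3)
          by (intro AE_I2 integral_peak_tendsto[OF f(1) C]) (auto simp: space)
        show "AE z in M. norm (I f n (s n z)) \<le> C" for n
          using bound s(2) by (intro AE_I2) (auto simp: space)
      qed simp
      then show ?thesis by (simp add: int_N[OF f])
    qed
    then have lim: "limitin (weak_topology ?H) N M sequentially"
      unfolding limitin_weak_topology using M subsetD[OF poincare_mixtures_subset N] by simp
    \<comment> \<open>A limit of a sequence of mixtures lies in the closure, since every open set
      around it contains some member of the sequence.\<close>
    show "M \<in> weak_topology ?H closure_of poincare_mixtures"
      unfolding in_closure_of
    proof (intro conjI allI impI)
      show "M \<in> topspace (weak_topology ?H)" using M by (simp add: topspace_weak_topology)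
      fix T assume "M \<in> T \<and> openin (weak_topology ?H) T"
      with lim have "\<forall>\<^sub>F n in sequentially. N n \<in> T" by (simp add: limitin_def)
      then obtain n where "N n \<in> T" by (auto simp: eventually_sequentially)
      with N show "\<exists>y. y \<in> poincare_mixtures \<and> y \<in> T" by blast
    qed
  qed
qed

end
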